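(* Let $R$ be a Furstenberg domain that has at least one irreducible element and only finitely many irreducible elements up to associates, say $f_1,\ldots,f_n$ (so $n \geq 1$ and every irreducible element of $R$ is associate to some $f_i$). Then: (a) $\# R^{\times} = \# R$ (equality of cardinalities). (b) More precisely, there is a nonzero ideal $I$ of $R$ such that $1 + I \subset R^{\times}$.
   Context: Rings are commutative with $1$; a domain is a nonzero ring without zero divisors; $R^{\times}$ is the unit group of $R$. Elements $x,y$ are associates if $y=ux$ for some $u\in R^\times$. An element of a domain is irreducible if it is a nonzero nonunit $x$ such that $x=yz$ implies $y$ or $z$ is a unit. A Furstenberg domain is a domain in which every nonzero nonunit is divisible by some irreducible element. *)

theory Defs
  imports "HOL-Algebra.Algebra" "HOL-Library.Equipollence"
begin

text \<open>
  \<^const>\<open>ring_irreducible\<close> does not itself require membership in the carrier, hence the explicit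
  bounds below. It is phrased via proper factors and \<^const>\<open>associated\<close> via mutual divisibility;
  in a domain these agree with the definitions via factorizations \<open>x = yz\<close> and via unit multiples.
\<close>

lemma (in domain) ring_irreducible_iff:
  assumes "x \<in> carrier R"
  shows "ring_irreducible x \<longleftrightarrow> x \<noteq> \<zero> \<and> x \<notin> Units R \<and>
    (\<forall>y\<in>carrier R. \<forall>z\<in>carrier R. x = y \<otimes> z \<longrightarrow> y \<in> Units R \<or> z \<in> Units R)"
  using assms ring_irreducibleE[OF assms] ring_irreducibleI[of x] by blast

lemma (in domain) associated_iff_unit_multiple:
  assumes "x \<in> carrier R" "y \<in> carrier R"
  shows "x \<sim> y \<longleftrightarrow> (\<exists>u\<in>Units R. y = u \<otimes> x)"
  using ring_associated_iff[OF assms(2,1)] by (auto simp: associated_def)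

locale Furstenberg_domain = domain +
  assumes irreducible_divisor:
    "\<lbrakk> a \<in> carrier R; a \<noteq> \<zero>; a \<notin> Units R \<rbrakk> \<Longrightarrow>
      \<exists>p\<in>carrier R. ring_irreducible p \<and> p divides a"

end

theory Submission
  imports Defs
begin

text \<open>
  Let \<open>q\<close> be the product of the \<open>f\<^sub>i\<close>. An element \<open>1 + xq\<close> is divisible by no \<open>f\<^sub>i\<close>, since otherwise
  \<open>f\<^sub>i\<close> would divide 1, and it is nonzero, since otherwise \<open>q\<close> would be a unit; here \<open>n \<ge> 1\<close>
  enters. So it is a unit by the Furstenberg property. The ideal is therefore \<open>(q)\<close>, and the
  injection \<open>x \<mapsto> 1 + xq\<close> of \<open>R\<close> into its unit group yields the equality of cardinalities.
\<close>

lemma (in comm_monoid) divides_finprod: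
  assumes "finite A" "f \<in> A \<rightarrow> carrier G" "i \<in> A"
  shows "f i divides finprod G f A"
proof -
  \<comment> \<open>Splitting off the factor at \<open>i\<close> exhibits the product over
    \<open>A - {i}\<close> as the cofactor.\<close>
  have "finprod G f (insert i (A - {i})) = f i \<otimes> finprod G f (A - {i})"
    using assms by (intro finprod_insert) auto
  moreover have "insert i (A - {i}) = A"
    using assms by auto
  moreover have "finprod G f (A - {i}) \<in> carrier G"
    using assms by (intro finprod_closed) auto
  ultimately show ?thesis
    by (auto simp: factor_def)
qed

lemma (in domain) finprod_nonzero:
  assumes "finite A" "f \<in> A \<rightarrow> carrier R - {\<zero>}"
  shows "finprod R f A \<noteq> \<zero>"
  using assms
proof (induction A rule: finite_induct)
  case empty
  then show ?case by simp
next
  case (insert i A)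
  then have "f \<in> A \<rightarrow> carrier R" and "f i \<in> carrier R"
    by auto
  with insert show ?case
    by (auto simp: integral_iff)
qed

text \<open>A common divisor of \<open>x\<close> and \<open>\<one> \<oplus> x\<close> divides their
  difference, which is \<open>\<one>\<close>.\<close>

lemma (in cring) unit_if_divides_and_divides_one_plus:
  assumes "p \<in> carrier R" "x \<in> carrier R" "p divides x" "p divides (\<one> \<oplus> x)"
  shows "p \<in> Units R"
proof -
  obtain c d where c: "c \<in> carrier R" "x = p \<otimes> c"
    and d: "d \<in> carrier R" "\<one> \<oplus> x = p \<otimes> d"
    using assms by (auto simp: factor_def)
  have "\<one> = (\<one> \<oplus> x) \<ominus> x"
    using assms(2) by algebra
  also have "\<dots> = p \<otimes> d \<ominus> p \<otimes> c"
    using c d by simp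
  also have "\<dots> = p \<otimes> (d \<ominus> c)"
    using assms(1) c(1) d(1) by algebra
  finally have "p divides \<one>"
    using c(1) d(1) by (intro dividesI[of "d \<ominus> c"]) auto
  then show ?thesis
    using assms(1) by (rule divides_unit) simp
qed

text \<open>Finiteness enters only through the existence of a nonunit \<open>q\<close> that all
  irreducibles divide, so the argument is stated for any such \<open>q\<close>.\<close>

lemma (in Furstenberg_domain) one_plus_multiple_unit:
  assumes q: "q \<in> carrier R" "q \<notin> Units R"
    and irr: "\<And>p. p \<in> carrier R \<Longrightarrow> ring_irreducible p \<Longrightarrow> p divides q"
    and x: "x \<in> carrier R"
  shows "\<one> \<oplus> x \<otimes> q \<in> Units R"
proof (rule ccontr)
  assume nonunit: "\<one> \<oplus> x \<otimes> q \<notin> Units R"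
  have "\<one> \<oplus> x \<otimes> q \<noteq> \<zero>"
  proof
    assume "\<one> \<oplus> x \<otimes> q = \<zero>"
    \<comment> \<open>Here \<open>q\<close> itself is the common divisor of
      \<open>x \<otimes> q\<close> and \<open>\<one> \<oplus> x \<otimes> q\<close>, the latter
      being zero.\<close>
    moreover have "q divides (x \<otimes> q)"
      using q x by (simp add: divides_prod_l)
    moreover have "q divides \<zero>"
      using q by (intro dividesI[of \<zero>]) auto
    ultimately have "q \<in> Units R"
      using q x by (intro unit_if_divides_and_divides_one_plus[of q "x \<otimes> q"]) auto
    with q show False by simp
  qed
  then obtain p where p: "p \<in> carrier R" "ring_irreducible p" "p divides (\<one> \<oplus> x \<otimes> q)"
    using irreducible_divisor[OF _ _ nonunit] q x by (metis a_closed m_closed one_closed)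
  have "p divides (x \<otimes> q)"
    using irr[OF p(1,2)] p(1) q x by (simp add: divides_prod_l)
  then have "p \<in> Units R"
    using p q x by (intro unit_if_divides_and_divides_one_plus[of p "x \<otimes> q"]) auto
  with p show False
    by (simp add: ring_irreducible_iff)
qed

text \<open>By Cantor-Bernstein, two injections suffice: the inclusion of the units, and
  \<open>x \<mapsto> \<one> \<oplus> x \<otimes> q\<close>, which is injective because a nonzero
  \<open>q\<close> can be cancelled.\<close>

lemma (in domain) Units_eqpoll_carrier_if_one_plus_multiples_units:
  assumes q: "q \<in> carrier R" "q \<noteq> \<zero>"
    and unit: "\<And>x. x \<in> carrier R \<Longrightarrow> \<one> \<oplus> x \<otimes> q \<in> Units R"
  shows "Units R \<approx> carrier R"
proof (rule lepoll_antisym)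
  show "lepoll (Units R) (carrier R)"
    by (intro subset_imp_lepoll) auto
  have "inj_on (\<lambda>x. \<one> \<oplus> x \<otimes> q) (carrier R)"
  proof (rule inj_onI)
    fix x y
    assume xy: "x \<in> carrier R" "y \<in> carrier R" "\<one> \<oplus> x \<otimes> q = \<one> \<oplus> y \<otimes> q"
    then have "x \<otimes> q = y \<otimes> q"
      using q by simp
    then show "x = y"
      using xy q m_rcancel by simp
  qed
  then show "lepoll (carrier R) (Units R)"
    using unit by (auto simp: lepoll_def)
qed

theorem theorem3p1:
  fixes R (structure) and f :: "nat \<Rightarrow> 'a" and n :: nat
  assumes "Furstenberg_domain R"
    and "n \<ge> 1"
    and "\<And>i. i \<in> {1..n} \<Longrightarrow> f i \<in> carrier R \<and> ring_irreducible (f i)"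
    and "\<And>p. p \<in> carrier R \<Longrightarrow> ring_irreducible p \<Longrightarrow> \<exists>i\<in>{1..n}. p \<sim> f i"
  shows "Units R \<approx> carrier R \<and>
    (\<exists>I. ideal I R \<and> I \<noteq> {\<zero>} \<and> \<one> <+ I \<subseteq> Units R)"
proof -
  interpret Furstenberg_domain R by fact
  define q where "q = finprod R f {1..n}"
  have f: "f \<in> {1..n} \<rightarrow> carrier R"
    using assms(3) by auto
  have f_dvd: "f i divides q" if "i \<in> {1..n}" for i
    unfolding q_def using f that by (intro divides_finprod) simp_all
  have q: "q \<in> carrier R"
    unfolding q_def using f by (rule finprod_closed)
  have q_nonzero: "q \<noteq> \<zero>"
    unfolding q_def
  proof (rule finprod_nonzero)
    show "f \<in> {1..n} \<rightarrow> carrier R - {\<zero>}"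
    proof
      fix i
      assume "i \<in> {1..n}"
      then show "f i \<in> carrier R - {\<zero>}"
        using assms(3)[of i] ring_irreducible_iff[of "f i"] by blast
    qed
  qed simp
  have q_nonunit: "q \<notin> Units R"
  proof
    assume "q \<in> Units R"
    \<comment> \<open>The index 1 is available because \<open>n \<ge> 1\<close>; for an empty
      product \<open>q\<close> would be \<open>\<one>\<close>. A divisor of a unit is a
      unit.\<close>
    moreover have f1: "f 1 \<in> carrier R" "ring_irreducible (f 1)" "f 1 divides q"
      using assms(2) assms(3)[of 1] f_dvd[of 1] by simp_all
    ultimately have "f 1 \<in> Units R"
      using divides_unit[of "f 1" q] by simp
    with f1 show False
      by (simp add: ring_irreducible_iff)
  qed
  have irr: "p divides q" if p: "p \<in> carrier R" "ring_irreducible p" for p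
  proof -
    obtain i where "i \<in> {1..n}" "p \<sim> f i"
      using assms(4) p by blast
    \<comment> \<open>Associates divide each other, so \<open>p\<close> divides \<open>f i\<close>,
      which divides \<open>q\<close>.\<close>
    then show ?thesis
      using divides_trans[OF _ f_dvd p(1)] by (blast dest: associatedD)
  qed
  note unit = one_plus_multiple_unit[OF q q_nonunit irr]
  have "ideal (PIdl q) R"
    using q by (rule cgenideal_ideal)
  moreover have "PIdl q \<noteq> {\<zero>}"
    using cgenideal_self[OF q] q_nonzero by auto
  \<comment> \<open>The elements of this coset are exactly the
    \<open>\<one> \<oplus> x \<otimes> q\<close>.\<close>
  moreover have "\<one> <+ PIdl q \<subseteq> Units R"
    using unit by (auto simp: a_l_coset_def' cgenideal_def)
  ultimately show ?thesis
    using Units_eqpoll_carrier_if_one_plus_multiples_units[OF q q_nonzero unit] by blast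
qed

end
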